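(* Let $n\ge 2$ and let $X$ be an $n$-dimensional real vector space partially ordered by a generating polyhedral cone $K$. Then the number of bands in $X$ does not exceed $\frac14\,2^{2^{n}}$.
   Context: A cone $K$ in a real vector space $X$ is a subset closed under addition and multiplication by nonnegative scalars with $K\cap(-K)=\{0\}$; $X$ is partially ordered by $x\le y$ iff $y-x\in K$. $K$ is generating if $X=K-K$. A closed cone in a finite dimensional space is polyhedral if it is the intersection of finitely many closed half-spaces. For $M\subseteq X$, $M^u$ is the set of upper bounds of $M$ in $X$. Elements $x,y\in X$ are disjoint, $x\perp y$, if $\{x+y,-x-y\}^u=\{x-y,-x+y\}^u$. The disjoint complement of $M\subseteq X$ is $M^d=\{y\in X\colon x\perp y\text{ for all }x\in M\}$. A linear subspace $B\subseteq X$ is a band if $(B^d)^d=B$. *)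

theory Defs
  imports "HOL-Analysis.Analysis"
begin

definition order_cone :: "'a::real_vector set \<Rightarrow> bool" where
  "order_cone K \<longleftrightarrow>
     (\<forall>x\<in>K. \<forall>y\<in>K. x + y \<in> K) \<and>
     (\<forall>x\<in>K. \<forall>c\<ge>0. c *\<^sub>R x \<in> K) \<and>
     K \<inter> uminus ` K = {0}"

definition cone_le :: "'a::real_vector set \<Rightarrow> 'a \<Rightarrow> 'a \<Rightarrow> bool" where
  "cone_le K x y \<longleftrightarrow> y - x \<in> K"

definition generating :: "'a::real_vector set \<Rightarrow> bool" where
  "generating K \<longleftrightarrow> UNIV = {a - b | a b. a \<in> K \<and> b \<in> K}"

text \<open>The following notions are only meant for finite-dimensional spaces
  (\<open>dim UNIV \<ge> 2\<close> ensures this, as \<open>dim\<close> is 0 for infinite-dimensional spaces). Every such space carries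
  exactly one Hausdorff vector space topology, and all linear functionals are continuous for it.
  Hence the closed half-spaces are the sets given below, and a finite intersection of them is
  automatically closed, so polyhedrality subsumes closedness. On Euclidean spaces the notion agrees
  with the library's polyhedra, see \<open>polyhedral_iff_polyhedron\<close>.\<close>

definition closed_halfspace :: "'a::real_vector set \<Rightarrow> bool" where
  "closed_halfspace H \<longleftrightarrow>
     (\<exists>(f :: 'a \<Rightarrow> real) b. linear f \<and> (\<exists>x. f x \<noteq> 0) \<and> H = {x. f x \<le> b})"

definition polyhedral :: "'a::real_vector set \<Rightarrow> bool" where
  "polyhedral K \<longleftrightarrow> (\<exists>F. finite F \<and> (\<forall>H\<in>F. closed_halfspace H) \<and> K = \<Inter>F)"

definition upper_bounds :: "'a::real_vector set \<Rightarrow> 'a set \<Rightarrow> 'a set" where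
  "upper_bounds K M = {u. \<forall>m\<in>M. cone_le K m u}"

definition disjoint_elems :: "'a::real_vector set \<Rightarrow> 'a \<Rightarrow> 'a \<Rightarrow> bool" where
  "disjoint_elems K x y \<longleftrightarrow>
     upper_bounds K {x + y, - x - y} = upper_bounds K {x - y, - x + y}"

definition disjoint_compl :: "'a::real_vector set \<Rightarrow> 'a set \<Rightarrow> 'a set" where
  "disjoint_compl K M = {y. \<forall>x\<in>M. disjoint_elems K x y}"

definition band :: "'a::real_vector set \<Rightarrow> 'a set \<Rightarrow> bool" where
  "band K B \<longleftrightarrow> subspace B \<and> disjoint_compl K (disjoint_compl K B) = B"

lemma closed_halfspace_euclidean:
  fixes H :: "'a::euclidean_space set"
  shows "closed_halfspace H \<longleftrightarrow> (\<exists>a b. a \<noteq> 0 \<and> H = {x. a \<bullet> x \<le> b})"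
proof
  assume "closed_halfspace H"
  then obtain f :: "'a \<Rightarrow> real" and b x
    where f: "linear f" "f x \<noteq> 0" and H: "H = {x. f x \<le> b}"
    by (auto simp: closed_halfspace_def)
  define a where "a = adjoint f 1"
  have eq: "f y = a \<bullet> y" for y
    using adjoint_works[OF f(1), of y 1] by (simp add: a_def inner_commute)
  then show "\<exists>a b. a \<noteq> 0 \<and> H = {x. a \<bullet> x \<le> b}"
  proof (intro exI conjI)
    show "a \<noteq> 0" using f(2) eq[of x] by auto
    show "H = {x. a \<bullet> x \<le> b}" by (simp add: H eq)
  qed
next
  assume "\<exists>a b. a \<noteq> 0 \<and> H = {x. a \<bullet> x \<le> b}"
  then obtain a b where a: "a \<noteq> 0" and H: "H = {x. a \<bullet> x \<le> b}"
    by blast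
  have "linear (\<lambda>x. a \<bullet> x)" "a \<bullet> a \<noteq> 0"
    using a by (auto intro: bounded_linear.linear bounded_linear_inner_right)
  then show "closed_halfspace H"
    unfolding closed_halfspace_def H
    by (intro exI[of _ "\<lambda>x. a \<bullet> x"] exI[of _ b]) (auto intro!: exI[of _ a])
qed

lemma polyhedral_iff_polyhedron:
  fixes K :: "'a::euclidean_space set"
  shows "polyhedral K \<longleftrightarrow> polyhedron K"
  unfolding polyhedral_def polyhedron_def closed_halfspace_euclidean
  by (simp only: conj_commute)

end

theory Submission
  imports Defs
begin

text \<open>If \<open>K\<close> is cut out by an irredundant finite set \<open>G\<close> of functionals, then \<open>x \<perp> y\<close> means that
  \<open>g x * g y = 0\<close> for all \<open>g \<in> G\<close>. So for every band \<open>B\<close>, each \<open>g \<in> G\<close> vanishes on \<open>B\<close> or on its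
  disjoint complement. Splitting \<open>G\<close> repeatedly along such pairs, starting from the zero subspace
  and adding \<open>B\<close> or its complement as long as some band contributes something new on both sides,
  gives a binary tree of strictly increasing subspaces. It has at most \<open>2 ^ (n - 1)\<close> proper
  subspaces as leaves, and a band is determined by the set of leaves containing it. This even gives the
  bound \<open>2 ^ (2 ^ (n - 1))\<close>.\<close>

section \<open>Dimension of subspaces\<close>

text \<open>A basis of an infinite-dimensional space has \<open>card\<close> 0, so positive
  \<open>dim\<close> of \<open>UNIV\<close> yields a finite basis, over which the finite-dimensional
  theory can be interpreted.\<close>

lemma dim_strict_mono:
  fixes S T :: "'a::real_vector set"
  assumes dim: "dim (UNIV :: 'a set) > 0" and S: "subspace S" and T: "subspace T" and ST: "S \<subset> T"
  shows "dim S < dim T"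
proof -
  obtain b :: "'a set" where ib: "independent b" and sb: "UNIV \<subseteq> span b"
    and cb: "card b = dim (UNIV :: 'a set)"
    using basis_exists[of "UNIV :: 'a set"] by metis
  have b: "independent b" "span b = UNIV" "finite b"
    using ib sb cb dim card_gt_0_iff[of b] by auto
  interpret fd: finite_dimensional_vector_space "(*\<^sub>R) :: real \<Rightarrow> 'a \<Rightarrow> 'a" b
    using b by unfold_locales (auto simp: dependent_raw_def span_raw_def)
  have "span S \<subset> span T"
    using S T ST by (metis span_eq_iff)
  then show ?thesis
    using fd.dim_psubset[of S T] unfolding span_raw_def dim_raw_def by blast
qed

section \<open>Functionals cutting out the cone\<close>

text \<open>The half-spaces may be affine. As \<open>K\<close> contains 0, their bounds are
  nonnegative; as \<open>K\<close> is closed under scaling, each bound can be tightened to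
  0.\<close>

lemma polyhedral_cone_functionals:
  fixes K :: "'a::real_vector set"
  assumes "order_cone K" and "polyhedral K"
  obtains G :: "('a \<Rightarrow> real) set"
  where "finite G" and "\<And>g. g \<in> G \<Longrightarrow> linear g" and "K = {x. \<forall>g\<in>G. g x \<ge> 0}"
proof -
  obtain F where F: "finite F" "\<forall>H\<in>F. closed_halfspace H" and K: "K = \<Inter>F"
    using assms(2) by (auto simp: polyhedral_def)
  have "\<forall>H\<in>F. \<exists>(f :: 'a \<Rightarrow> real) b. linear f \<and> (\<forall>x. x \<in> H \<longleftrightarrow> f x \<le> b)"
  proof
    fix H assume "H \<in> F"
    then obtain f :: "'a \<Rightarrow> real" and b where "linear f" "H = {x. f x \<le> b}"
      using F(2) unfolding closed_halfspace_def by metis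
    then show "\<exists>(f :: 'a \<Rightarrow> real) b. linear f \<and> (\<forall>x. x \<in> H \<longleftrightarrow> f x \<le> b)"
      by (intro exI[of _ f] exI[of _ b]) simp
  qed
  then obtain f :: "'a set \<Rightarrow> 'a \<Rightarrow> real" and b
    where "\<forall>H\<in>F. linear (f H) \<and> (\<forall>x. x \<in> H \<longleftrightarrow> f H x \<le> b H)"
    unfolding bchoice_iff by blast
  then have f: "\<And>H. H \<in> F \<Longrightarrow> linear (f H)"
    and H: "\<And>H x. H \<in> F \<Longrightarrow> x \<in> H \<longleftrightarrow> f H x \<le> b H"
    by simp_all
  have "0 \<in> K"
    using assms(1) by (auto simp: order_cone_def)
  then have b: "b H \<ge> 0" if "H \<in> F" for H
  proof -
    have "f H 0 \<le> b H" using \<open>0 \<in> K\<close> H[OF that] K that by blast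
    then show ?thesis by (simp add: linear_0[OF f[OF that]])
  qed
  have neg: "f H x \<le> 0" if x: "x \<in> K" and HF: "H \<in> F" for H x
  proof (rule ccontr)
    assume pos: "\<not> f H x \<le> 0"
    \<comment> \<open>Chosen so that \<open>f H (c *\<^sub>R x) = b H + 1\<close>.\<close>
    define c where "c = (b H + 1) / f H x"
    have "c \<ge> 0" using pos b[OF HF] by (simp add: c_def)
    then have "c *\<^sub>R x \<in> K" using assms(1) x by (auto simp: order_cone_def)
    then have "f H (c *\<^sub>R x) \<le> b H" using H[OF HF] K HF by blast
    then show False using pos by (simp add: c_def linear_scale[OF f[OF HF]])
  qed
  show thesis
  proof
    show "finite ((\<lambda>H x. - f H x) ` F)" using F(1) by simp
    show "linear g" if "g \<in> (\<lambda>H x. - f H x) ` F" for g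
      using that f by (auto intro: linear_compose_neg)
    have "x \<in> K" if "\<forall>H\<in>F. f H x \<le> 0" for x
      unfolding K using that H b by (blast intro: order_trans)
    then show "K = {x. \<forall>g\<in>(\<lambda>H x. - f H x) ` F. g x \<ge> 0}"
      using neg by auto
  qed
qed

text \<open>Take a defining set of least cardinality: if no point violated \<open>g\<close> alone,
  \<open>g\<close> could be dropped.\<close>

lemma polyhedral_cone_irredundant:
  fixes K :: "'a::real_vector set"
  assumes "order_cone K" and "polyhedral K"
  obtains G :: "('a \<Rightarrow> real) set"
  where "finite G" and "\<And>g. g \<in> G \<Longrightarrow> linear g" and "K = {x. \<forall>g\<in>G. g x \<ge> 0}"
    and "\<And>g. g \<in> G \<Longrightarrow> \<exists>z. g z < 0 \<and> (\<forall>h\<in>G - {g}. h z \<ge> 0)"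
proof -
  define P where "P G \<longleftrightarrow> finite G \<and> (\<forall>g\<in>G. linear g) \<and> K = {x. \<forall>g\<in>G. g x \<ge> 0}"
    for G :: "('a \<Rightarrow> real) set"
  obtain G where G: "P G" and min: "\<And>G'. P G' \<Longrightarrow> card G \<le> card G'"
  proof -
    have "\<exists>G. P G"
      by (rule polyhedral_cone_functionals[OF assms]) (unfold P_def, blast)
    then obtain G0 where "P G0" ..
    from ex_has_least_nat[of P, OF this, of card] show thesis
      using that by blast
  qed
  have "\<exists>z. g z < 0 \<and> (\<forall>h\<in>G - {g}. h z \<ge> 0)" if g: "g \<in> G" for g
  proof (rule ccontr)
    assume "\<not> ?thesis"
    then have "P (G - {g})"
      using G unfolding P_def by (auto simp: not_less)
    then show False
      using min[of "G - {g}"] card_Diff1_less[of G g] G g by (simp add: P_def)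
  qed
  then show thesis
    using G that unfolding P_def by blast
qed

section \<open>Disjointness through functionals\<close>

text \<open>The upper bounds of \<open>{v, - v}\<close> are the \<open>u\<close> with
  \<open>\<bar>g v\<bar> \<le> g u\<close> for all \<open>g\<close>. By irredundancy each of these
  bounds is attained, so the set determines every \<open>\<bar>g v\<bar>\<close>; and
  \<open>\<bar>a + b\<bar> = \<bar>a - b\<bar>\<close> means \<open>a * b = 0\<close>.\<close>

lemma disjoint_elems_iff:
  fixes K :: "'a::real_vector set" and G :: "('a \<Rightarrow> real) set"
  assumes gen: "generating K" and fin: "finite G" and lin: "\<And>g. g \<in> G \<Longrightarrow> linear g"
    and K: "K = {x. \<forall>g\<in>G. g x \<ge> 0}"
    and irr: "\<And>g. g \<in> G \<Longrightarrow> \<exists>z. g z < 0 \<and> (\<forall>h\<in>G - {g}. h z \<ge> 0)"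
  shows "disjoint_elems K x y \<longleftrightarrow> (\<forall>g\<in>G. g x * g y = 0)"
proof -
  have ub: "upper_bounds K {v, - v} = {u. \<forall>g\<in>G. \<bar>g v\<bar> \<le> g u}" for v
  proof -
    have "g (u - v) \<ge> 0 \<and> g (u - - v) \<ge> 0 \<longleftrightarrow> \<bar>g v\<bar> \<le> g u" if "g \<in> G" for g u
      by (auto simp: linear_diff linear_add lin[OF that])
    then show ?thesis
      by (auto simp: upper_bounds_def cone_le_def K simp del: diff_minus_eq_add)
  qed
  have dis: "disjoint_elems K x y \<longleftrightarrow>
      {u. \<forall>g\<in>G. \<bar>g (x + y)\<bar> \<le> g u} = {u. \<forall>g\<in>G. \<bar>g (x - y)\<bar> \<le> g u}"
    using ub[of "x + y"] ub[of "x - y"] by (simp add: disjoint_elems_def)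
  \<comment> \<open>As \<open>K\<close> is generating, no \<open>g\<close> can vanish on all of
    \<open>K\<close>.\<close>
  have "\<exists>e\<in>K. g e > 0" if g: "g \<in> G" for g
  proof -
    obtain z where z: "g z < 0" using irr[OF g] by blast
    obtain a c where "a \<in> K" "c \<in> K" "z = a - c"
      using gen unfolding generating_def by blast
    then show ?thesis
      using z g lin[OF g] by (intro bexI[of _ c]) (auto simp: K linear_diff)
  qed
  then obtain e where e: "\<And>g. g \<in> G \<Longrightarrow> e g \<in> K \<and> g (e g) > 0" by metis
  \<comment> \<open>An interior point of \<open>K\<close>: each \<open>g\<close> is nonnegative on
    all summands and positive on its own.\<close>
  define i where "i = sum e G"
  have i: "g i > 0" if g: "g \<in> G" for g
    unfolding i_def linear_sum[OF lin[OF g]]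
    using fin g e by (intro sum_pos2[of _ g]) (auto simp: K)
  have key: "\<exists>u. g u = \<bar>g v\<bar> \<and> (\<forall>h\<in>G. \<bar>h v\<bar> \<le> h u)" if g: "g \<in> G" for g v
  proof -
    obtain z where z: "g z < 0" "\<And>h. h \<in> G - {g} \<Longrightarrow> h z \<ge> 0" using irr[OF g] by blast
    \<comment> \<open>Moving \<open>z\<close> towards the interior until \<open>g\<close> vanishes
      gives a point of the facet of \<open>g\<close> where all other functionals are
      positive.\<close>
    define z' where "z' = z + (- g z / g i) *\<^sub>R i"
    have gz': "g z' = 0"
      using i[OF g] by (simp add: z'_def linear_add linear_diff linear_scale lin g)
    have hz': "h z' > 0" if h: "h \<in> G - {g}" for h
    proof -
      have "- g z / g i * h i > 0" using z(1) i g h by (intro mult_pos_pos divide_pos_pos) auto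
      then show ?thesis
        using z(2)[OF h] h by (simp add: z'_def linear_add linear_diff linear_scale lin)
    qed
    \<comment> \<open>In \<open>u\<close>, the multiple of \<open>i\<close> sets the value of
      \<open>g\<close>. The multiple of \<open>z'\<close> is invisible to \<open>g\<close>, and
      \<open>s\<close> dominates each ratio, so every other \<open>h\<close> is raised far
      enough.\<close>
    define s where "s = (\<Sum>h\<in>G - {g}. \<bar>h v\<bar> / h z')"
    define u where "u = s *\<^sub>R z' + (\<bar>g v\<bar> / g i) *\<^sub>R i"
    have gu: "g u = \<bar>g v\<bar>"
      using i[OF g] by (simp add: u_def linear_add linear_scale lin g gz')
    have "\<bar>h v\<bar> \<le> h u" if h: "h \<in> G - {g}" for h
    proof -
      have "\<bar>h v\<bar> / h z' \<le> s"
        unfolding s_def using fin h hz'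
        by (intro member_le_sum[where f = "\<lambda>h. \<bar>h v\<bar> / h z'"]) (auto simp: less_imp_le)
      then have "\<bar>h v\<bar> \<le> s * h z'" using hz'[OF h] by (simp add: pos_divide_le_eq)
      moreover have "\<bar>g v\<bar> / g i * h i \<ge> 0"
        using i[OF g] i[of h] h by simp
      ultimately show ?thesis
        using h by (simp add: u_def linear_add linear_scale lin)
    qed
    then show ?thesis using gu by (metis DiffI order_refl singletonD)
  qed
  show ?thesis
  proof
    assume "disjoint_elems K x y"
    then have eq: "(\<forall>g\<in>G. \<bar>g (x + y)\<bar> \<le> g u) \<longleftrightarrow> (\<forall>g\<in>G. \<bar>g (x - y)\<bar> \<le> g u)" for u
      unfolding dis by blast
    show "\<forall>g\<in>G. g x * g y = 0"
    proof
      fix g assume g: "g \<in> G"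
      \<comment> \<open>The \<open>u\<close> attaining \<open>\<bar>g (x + y)\<bar>\<close> must
        also satisfy the inequalities for \<open>x - y\<close>.\<close>
      have "\<bar>g (x - y)\<bar> \<le> \<bar>g (x + y)\<bar>" using key[OF g, of "x + y"] eq g by metis
      moreover have "\<bar>g (x + y)\<bar> \<le> \<bar>g (x - y)\<bar>" using key[OF g, of "x - y"] eq g by metis
      ultimately have "\<bar>g x + g y\<bar> = \<bar>g x - g y\<bar>"
        by (simp add: linear_add linear_diff lin g)
      then show "g x * g y = 0" by (auto simp: abs_eq_iff)
    qed
  next
    assume 0: "\<forall>g\<in>G. g x * g y = 0"
    have "\<bar>g (x + y)\<bar> = \<bar>g (x - y)\<bar>" if "g \<in> G" for g
      using 0 that by (auto simp: linear_add linear_diff lin)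
    then show "disjoint_elems K x y" by (simp add: dis)
  qed
qed

section \<open>The tree of subspaces\<close>

text \<open>Induction on the codimension of the node \<open>A\<close>, with \<open>L\<close> the
  proper leaves below it. A functional vanishing on \<open>A\<close> vanishes on one of the two
  children, so it can be followed down to a leaf. The factor 2 in the bound forces \<open>L\<close>
  to be empty in codimension 0.\<close>

lemma separating_subspaces:
  fixes G :: "('a::real_vector \<Rightarrow> real) set" and P :: "('a set \<times> 'a set) set"
  assumes dim: "dim (UNIV :: 'a set) > 0"
    and lin: "\<And>g. g \<in> G \<Longrightarrow> linear g" and nz: "\<And>g. g \<in> G \<Longrightarrow> \<exists>x. g x \<noteq> 0"
    and split: "\<And>g B C. g \<in> G \<Longrightarrow> (B, C) \<in> P \<Longrightarrow> (\<forall>x\<in>B. g x = 0) \<or> (\<forall>x\<in>C. g x = 0)"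
    and A: "subspace A"
  shows "\<exists>L. finite L \<and> 2 * card L \<le> 2 ^ (dim (UNIV :: 'a set) - dim A) \<and>
    (\<forall>g\<in>G. (\<forall>x\<in>A. g x = 0) \<longrightarrow> (\<exists>l\<in>L. \<forall>x\<in>l. g x = 0)) \<and>
    (\<forall>l\<in>L. \<forall>(B, C)\<in>P. B \<subseteq> l \<or> C \<subseteq> l)"
  using A
proof (induction "dim (UNIV :: 'a set) - dim A" arbitrary: A rule: less_induct)
  case less
  let ?n = "dim (UNIV :: 'a set)"
  have lt: "dim A < dim T" if "subspace T" "A \<subset> T" for T
    using dim_strict_mono[OF dim less.prems that] .
  consider "A = UNIV" | "A \<noteq> UNIV" "\<forall>(B, C)\<in>P. B \<subseteq> A \<or> C \<subseteq> A"
    | B C where "A \<noteq> UNIV" "(B, C) \<in> P" "\<not> B \<subseteq> A" "\<not> C \<subseteq> A"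
    by blast
  then show ?case
  proof cases
    case 1
    \<comment> \<open>No functional in \<open>G\<close> vanishes on the whole space, so this leaf
      can be discarded.\<close>
    then show ?thesis using nz by (intro exI[of _ "{}"]) auto
  next
    case 2
    have "dim A < ?n" using lt[of UNIV] 2(1) by auto
    then have "2 ^ 1 \<le> (2::nat) ^ (?n - dim A)" by (intro power_increasing) auto
    then show ?thesis using 2(2) by (intro exI[of _ "{A}"]) auto
  next
    case (3 B C)
    have n: "dim A < ?n" using lt[of UNIV] 3(1) by auto
    \<comment> \<open>\<open>D\<close> will be \<open>B\<close> and \<open>C\<close>: either child
      has smaller codimension, so each branch gets half of the bound.\<close>
    have IH: "\<exists>L. finite L \<and> 2 * card L \<le> 2 ^ (?n - dim A - 1) \<and>
      (\<forall>g\<in>G. (\<forall>x\<in>span (A \<union> D). g x = 0) \<longrightarrow> (\<exists>l\<in>L. \<forall>x\<in>l. g x = 0)) \<and>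
      (\<forall>l\<in>L. \<forall>(B, C)\<in>P. B \<subseteq> l \<or> C \<subseteq> l)" if D: "\<not> D \<subseteq> A" for D
    proof -
      let ?T = "span (A \<union> D)"
      have "A \<subset> ?T" using D span_superset[of "A \<union> D"] by auto
      then have T: "dim A < dim ?T" by (rule lt[OF subspace_span])
      then have "?n - dim ?T < ?n - dim A" using n by auto
      from less.hyps[OF this subspace_span] obtain L where
        L: "finite L" "2 * card L \<le> 2 ^ (?n - dim ?T)"
          "\<forall>g\<in>G. (\<forall>x\<in>?T. g x = 0) \<longrightarrow> (\<exists>l\<in>L. \<forall>x\<in>l. g x = 0)"
          "\<forall>l\<in>L. \<forall>(B, C)\<in>P. B \<subseteq> l \<or> C \<subseteq> l" by blast
      have "(2::nat) ^ (?n - dim ?T) \<le> 2 ^ (?n - dim A - 1)"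
        using T by (intro power_increasing) auto
      then have "2 * card L \<le> 2 ^ (?n - dim A - 1)" using L(2) by (rule order_trans[rotated])
      with L show ?thesis by blast
    qed
    obtain L1 where L1: "finite L1" "2 * card L1 \<le> 2 ^ (?n - dim A - 1)"
      "\<forall>g\<in>G. (\<forall>x\<in>span (A \<union> B). g x = 0) \<longrightarrow> (\<exists>l\<in>L1. \<forall>x\<in>l. g x = 0)"
      "\<forall>l\<in>L1. \<forall>(B, C)\<in>P. B \<subseteq> l \<or> C \<subseteq> l" using IH[OF 3(3)] by blast
    obtain L2 where L2: "finite L2" "2 * card L2 \<le> 2 ^ (?n - dim A - 1)"
      "\<forall>g\<in>G. (\<forall>x\<in>span (A \<union> C). g x = 0) \<longrightarrow> (\<exists>l\<in>L2. \<forall>x\<in>l. g x = 0)"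
      "\<forall>l\<in>L2. \<forall>(B, C)\<in>P. B \<subseteq> l \<or> C \<subseteq> l" using IH[OF 3(4)] by blast
    have "2 * card (L1 \<union> L2) \<le> 2 * 2 ^ (?n - dim A - 1)"
      using card_Un_le[of L1 L2] L1(2) L2(2) by linarith
    also have "\<dots> = 2 ^ (?n - dim A)"
      using n by (simp flip: power_Suc)
    finally have card: "2 * card (L1 \<union> L2) \<le> 2 ^ (?n - dim A)" .
    have "\<exists>l\<in>L1 \<union> L2. \<forall>x\<in>l. g x = 0" if g: "g \<in> G" "\<forall>x\<in>A. g x = 0" for g
    proof -
      have ext: "\<forall>x\<in>span (A \<union> D). g x = 0" if "\<forall>x\<in>D. g x = 0" for D
        using linear_eq_0_on_span[OF lin[OF g(1)], of "A \<union> D"] g(2) that by blast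
      from split[OF g(1) 3(2)] show ?thesis
      proof
        assume "\<forall>x\<in>B. g x = 0"
        then have "\<exists>l\<in>L1. \<forall>x\<in>l. g x = 0" using ext L1(3) g(1) by simp
        then show ?thesis by blast
      next
        assume "\<forall>x\<in>C. g x = 0"
        then have "\<exists>l\<in>L2. \<forall>x\<in>l. g x = 0" using ext L2(3) g(1) by simp
        then show ?thesis by blast
      qed
    qed
    moreover have "\<forall>l\<in>L1 \<union> L2. \<forall>(B, C)\<in>P. B \<subseteq> l \<or> C \<subseteq> l"
      using L1(4) L2(4) by (simp add: ball_Un)
    ultimately show ?thesis
      using card L1(1) L2(1) by (intro exI[of _ "L1 \<union> L2"] conjI ballI impI) auto
  qed
qed

section \<open>Counting the bands\<close>

theorem theorem30:
  fixes K :: "'a::real_vector set" and n :: nat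
  assumes "n \<ge> 2"
    and "dim (UNIV :: 'a set) = n"
    and "order_cone K"
    and "generating K"
    and "polyhedral K"
  shows "finite {B. band K B} \<and> real (card {B. band K B}) \<le> 1 / 4 * 2 ^ (2 ^ n)"
proof -
  obtain G :: "('a \<Rightarrow> real) set"
    where fin: "finite G" and lin: "\<And>g. g \<in> G \<Longrightarrow> linear g" and K: "K = {x. \<forall>g\<in>G. g x \<ge> 0}"
      and irr: "\<And>g. g \<in> G \<Longrightarrow> \<exists>z. g z < 0 \<and> (\<forall>h\<in>G - {g}. h z \<ge> 0)"
    by (rule polyhedral_cone_irredundant[OF assms(3,5)]) (rule that)
  have dis: "disjoint_elems K x y \<longleftrightarrow> (\<forall>g\<in>G. g x * g y = 0)" for x y
    using disjoint_elems_iff[OF assms(4) fin lin K irr] .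
  define P where "P = (\<lambda>B. (B, disjoint_compl K B)) ` {B. band K B}"
  \<comment> \<open>At the root \<open>{0}\<close> all functionals vanish, so each \<open>g\<close>
    in \<open>G\<close> reaches some leaf.\<close>
  have "\<exists>L. finite L \<and> 2 * card L \<le> 2 ^ (dim (UNIV :: 'a set) - dim {0 :: 'a}) \<and>
    (\<forall>g\<in>G. (\<forall>x\<in>{0}. g x = 0) \<longrightarrow> (\<exists>l\<in>L. \<forall>x\<in>l. g x = 0)) \<and>
    (\<forall>l\<in>L. \<forall>(B, C)\<in>P. B \<subseteq> l \<or> C \<subseteq> l)"
  proof (rule separating_subspaces)
    show "\<exists>x. g x \<noteq> 0" if "g \<in> G" for g using irr[OF that] by (metis less_irrefl)
    show "(\<forall>x\<in>B. g x = 0) \<or> (\<forall>x\<in>C. g x = 0)" if "g \<in> G" "(B, C) \<in> P" for g B C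
      using that by (force simp: P_def disjoint_compl_def dis)
  qed (use assms(1,2) lin in \<open>auto simp: subspace_single_0\<close>)
  then obtain L where finL: "finite L" and cardL: "2 * card L \<le> 2 ^ (n - dim {0 :: 'a})"
    and van: "\<forall>g\<in>G. (\<forall>x\<in>{0}. g x = 0) \<longrightarrow> (\<exists>l\<in>L. \<forall>x\<in>l. g x = 0)"
    and sep: "\<forall>l\<in>L. \<forall>(B, C)\<in>P. B \<subseteq> l \<or> C \<subseteq> l"
    unfolding assms(2) by blast
  have vanish: "\<exists>l\<in>L. \<forall>x\<in>l. g x = 0" if "g \<in> G" for g
    using van that by (simp add: linear_0[OF lin[OF that]])
  have separate: "B \<subseteq> l \<or> disjoint_compl K B \<subseteq> l" if "l \<in> L" "band K B" for l B
    using sep that unfolding P_def by blast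
  define S where "S B = {l \<in> L. B \<subseteq> l}" for B
  \<comment> \<open>To place \<open>x\<close> in the double complement of \<open>C\<close>, pick a
    leaf in the kernel of \<open>g\<close>. It contains \<open>C\<close>, hence also
    \<open>B\<close> and \<open>x\<close>, or else the complement of \<open>C\<close>, hence
    \<open>y\<close>.\<close>
  have sub: "B \<subseteq> C" if "band K C" "S B = S C" for B C
  proof
    fix x assume x: "x \<in> B"
    have "g x * g y = 0" if y: "y \<in> disjoint_compl K C" and g: "g \<in> G" for g y
    proof -
      obtain l where l: "l \<in> L" "\<forall>x\<in>l. g x = 0" using vanish[OF g] by blast
      consider "C \<subseteq> l" | "disjoint_compl K C \<subseteq> l" using separate[OF l(1) \<open>band K C\<close>] by blast
      then show ?thesis
      proof cases
        case 1
        then have "B \<subseteq> l" using \<open>S B = S C\<close> l(1) by (auto simp: S_def)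
        then show ?thesis using x l(2) by auto
      next
        case 2
        then show ?thesis using y l(2) by auto
      qed
    qed
    then have "x \<in> disjoint_compl K (disjoint_compl K C)"
      by (subst disjoint_compl_def) (auto simp: dis)
    then show "x \<in> C" using \<open>band K C\<close> by (simp add: band_def)
  qed
  have inj: "inj_on S {B. band K B}"
    by (rule inj_onI) (use sub in blast)
  have ran: "S ` {B. band K B} \<subseteq> Pow L" by (auto simp: S_def)
  have finB: "finite {B. band K B}"
    using inj_on_finite[OF inj ran] finL by simp
  have "card {B. band K B} \<le> 2 ^ card L"
    using card_inj_on_le[OF inj ran] finL by (simp add: card_Pow)
  \<comment> \<open>The added 2 accounts for the factor 1/4; both \<open>card L\<close> and 2 are at
    most half of \<open>2 ^ n\<close>, the latter because \<open>n \<ge> 2\<close>.\<close>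
  moreover have "card L + 2 \<le> 2 ^ n"
  proof -
    have "2 ^ 2 \<le> (2::nat) ^ n" using assms(1) by (intro power_increasing) auto
    moreover have "2 ^ (n - dim {0 :: 'a}) \<le> (2::nat) ^ n" by (intro power_increasing) auto
    ultimately show ?thesis using cardL unfolding power2_eq_square by linarith
  qed
  then have "(2::nat) ^ (card L + 2) \<le> 2 ^ (2 ^ n)" by (intro power_increasing) auto
  ultimately have "4 * card {B. band K B} \<le> 2 ^ (2 ^ n)" by simp
  then have "real (4 * card {B. band K B}) \<le> real (2 ^ (2 ^ n))"
    by (rule of_nat_mono)
  then show ?thesis using finB by simp
qed

end
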